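(* For each positive integer $n$, there is an extension $\tilde{R}_{2n+1}$ of the dihedral quandle $R_{2n+1}$ such that $\tilde{R}_{2n+1}$ admits a non-trivial good involution $\rho$, is connected, and is not involutory.
   Context: A quandle is a set $X$ with a binary operation $(x,y)\mapsto x\triangleleft y$ such that: (I) $x\triangleleft x=x$ for all $x$; (II) for all $x,y\in X$ there is a unique $z\in X$, denoted $x\triangleleft\bar{y}$, with $x=z\triangleleft y$; (III) $(x\triangleleft y)\triangleleft z=(x\triangleleft z)\triangleleft(y\triangleleft z)$ for all $x,y,z$. A quandle homomorphism is a map preserving $\triangleleft$. The dihedral quandle $R_m$ is $\mathbb{Z}_m=\mathbb{Z}/m\mathbb{Z}$ with $i\triangleleft j=2j-i \pmod m$. An extension of a quandle $X$ is a quandle $E$ together with a surjective quandle homomorphism $f:E\to X$ such that the cardinality of $f^{-1}(x)$ is the same for all $x\in X$. A good involution on a quandle $X$ is an involution $\rho:X\to X$ (i.e. $\rho\circ\rho=\mathrm{id}$) with $x\triangleleft\rho(y)=x\triangleleft\bar{y}$ and $\rho(x\triangleleft y)=\rho(x)\triangleleft y$ for all $x,y\in X$. It is trivial if it is the identity map, and non-trivial otherwise. For $c\in X$ the symmetry $S_c:X\to X$ is the quandle automorphism $x\mapsto x\triangleleft c$. The inner automorphism group $\mathrm{Inn}(X)$ is the group generated by all $S_c$, $c\in X$. The quandle $X$ is connected if $\mathrm{Inn}(X)$ acts transitively on $X$. It is involutory if $(x\triangleleft y)\triangleleft y=x$ for all $x,y\in X$. *)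

theory Defs
  imports "HOL-Algebra.Bij" "HOL-Algebra.Generated_Groups" "HOL-Library.Equipollence"
begin

locale quandle =
  fixes Q :: "'a set" and qop :: "'a \<Rightarrow> 'a \<Rightarrow> 'a" (infixl \<open>\<triangleleft>\<close> 70)
  assumes closed: "x \<in> Q \<Longrightarrow> y \<in> Q \<Longrightarrow> x \<triangleleft> y \<in> Q"
    and idem: "x \<in> Q \<Longrightarrow> x \<triangleleft> x = x"
    and unique_quotient: "x \<in> Q \<Longrightarrow> y \<in> Q \<Longrightarrow> \<exists>!z. z \<in> Q \<and> x = z \<triangleleft> y"
    and self_distrib: "x \<in> Q \<Longrightarrow> y \<in> Q \<Longrightarrow> z \<in> Q \<Longrightarrow>
      (x \<triangleleft> y) \<triangleleft> z = (x \<triangleleft> z) \<triangleleft> (y \<triangleleft> z)"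
begin

definition qinv :: "'a \<Rightarrow> 'a \<Rightarrow> 'a" (infixl \<open>\<triangleleft>\<inverse>\<close> 70) where
  "x \<triangleleft>\<inverse> y = (THE z. z \<in> Q \<and> x = z \<triangleleft> y)"

definition good_involution :: "('a \<Rightarrow> 'a) \<Rightarrow> bool" where
  "good_involution \<rho> \<longleftrightarrow> \<rho> \<in> Q \<rightarrow> Q \<and> (\<forall>x\<in>Q. \<rho> (\<rho> x) = x) \<and>
    (\<forall>x\<in>Q. \<forall>y\<in>Q. x \<triangleleft> \<rho> y = x \<triangleleft>\<inverse> y) \<and>
    (\<forall>x\<in>Q. \<forall>y\<in>Q. \<rho> (x \<triangleleft> y) = \<rho> x \<triangleleft> y)"

definition trivial_involution :: "('a \<Rightarrow> 'a) \<Rightarrow> bool" where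
  "trivial_involution \<rho> \<longleftrightarrow> (\<forall>x\<in>Q. \<rho> x = x)"

(* Undefined off Q, as HOL-Algebra requires of the elements of BijGroup Q. *)
definition symmetry :: "'a \<Rightarrow> 'a \<Rightarrow> 'a" where
  "symmetry c = (\<lambda>x\<in>Q. x \<triangleleft> c)"

lemma symmetry_in_BijGroup:
  assumes "c \<in> Q"
  shows "symmetry c \<in> carrier (BijGroup Q)"
proof -
  have "bij_betw (\<lambda>x. x \<triangleleft> c) Q Q"
    unfolding bij_betw_def
  proof
    show "inj_on (\<lambda>x. x \<triangleleft> c) Q"
    proof (rule inj_onI)
      fix x y
      assume "x \<in> Q" "y \<in> Q" "x \<triangleleft> c = y \<triangleleft> c"
      then show "x = y"
        using unique_quotient[OF closed[OF \<open>x \<in> Q\<close> assms] assms] by blast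
    qed
    show "(\<lambda>x. x \<triangleleft> c) ` Q = Q"
    proof
      show "(\<lambda>x. x \<triangleleft> c) ` Q \<subseteq> Q"
        using closed assms by blast
      show "Q \<subseteq> (\<lambda>x. x \<triangleleft> c) ` Q"
        using unique_quotient[OF _ assms] by blast
    qed
  qed
  then have "bij_betw (symmetry c) Q Q"
    unfolding symmetry_def by simp
  then show ?thesis
    by (simp add: BijGroup_def Bij_def symmetry_def)
qed

definition Inn :: "('a \<Rightarrow> 'a) set" where
  "Inn = generate (BijGroup Q) (symmetry ` Q)"

definition connected :: bool where
  "connected \<longleftrightarrow> (\<forall>x\<in>Q. \<forall>y\<in>Q. \<exists>g\<in>Inn. g x = y)"

definition involutory :: bool where
  "involutory \<longleftrightarrow> (\<forall>x\<in>Q. \<forall>y\<in>Q. (x \<triangleleft> y) \<triangleleft> y = x)"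

end

definition quandle_hom ::
    "'a set \<Rightarrow> ('a \<Rightarrow> 'a \<Rightarrow> 'a) \<Rightarrow> 'b set \<Rightarrow> ('b \<Rightarrow> 'b \<Rightarrow> 'b) \<Rightarrow> ('a \<Rightarrow> 'b) \<Rightarrow> bool" where
  "quandle_hom E t X s f \<longleftrightarrow> f \<in> E \<rightarrow> X \<and> (\<forall>x\<in>E. \<forall>y\<in>E. f (t x y) = s (f x) (f y))"

(* Fibres are compared by equipollence, since card is 0 on infinite sets. *)
definition quandle_extension ::
    "'a set \<Rightarrow> ('a \<Rightarrow> 'a \<Rightarrow> 'a) \<Rightarrow> 'b set \<Rightarrow> ('b \<Rightarrow> 'b \<Rightarrow> 'b) \<Rightarrow> ('a \<Rightarrow> 'b) \<Rightarrow> bool" where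
  "quandle_extension E t X s f \<longleftrightarrow> quandle E t \<and> quandle X s \<and>
    quandle_hom E t X s f \<and> f ` E = X \<and>
    (\<forall>x\<in>X. \<forall>y\<in>X. {e \<in> E. f e = x} \<approx> {e \<in> E. f e = y})"

(* Residues mod m are represented by 0, ..., m - 1; only meaningful for m > 0. *)
definition dihedral_carrier :: "nat \<Rightarrow> int set" where
  "dihedral_carrier m = {0..<int m}"

definition dihedral_op :: "nat \<Rightarrow> int \<Rightarrow> int \<Rightarrow> int" where
  "dihedral_op m i j = (2 * j - i) mod int m"

lemma quandle_dihedral:
  assumes "m > 0"
  shows "quandle (dihedral_carrier m) (dihedral_op m)"
proof
  fix x y z
  assume x: "x \<in> dihedral_carrier m" and y: "y \<in> dihedral_carrier m"
  show "dihedral_op m x y \<in> dihedral_carrier m"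
    using assms by (simp add: dihedral_carrier_def dihedral_op_def)
  show "dihedral_op m x x = x"
    using x by (simp add: dihedral_carrier_def dihedral_op_def)
  show "\<exists>!w. w \<in> dihedral_carrier m \<and> x = dihedral_op m w y"
  proof (rule ex1I[of _ "dihedral_op m x y"])
    have "(2 * y - (2 * y - x) mod int m) mod int m = x"
      using x by (simp add: mod_diff_right_eq dihedral_carrier_def)
    then show "dihedral_op m x y \<in> dihedral_carrier m \<and> x = dihedral_op m (dihedral_op m x y) y"
      using assms by (simp add: dihedral_carrier_def dihedral_op_def)
  next
    fix w
    assume w: "w \<in> dihedral_carrier m \<and> x = dihedral_op m w y"
    have "(2 * y - (2 * y - w) mod int m) mod int m = w"
      using w by (simp add: mod_diff_right_eq dihedral_carrier_def)
    then show "w = dihedral_op m x y"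
      using w by (simp add: dihedral_op_def)
  qed
  show "dihedral_op m (dihedral_op m x y) z =
      dihedral_op m (dihedral_op m x z) (dihedral_op m y z)"
  proof -
    have "(2 * ((2 * z - y) mod int m) - (2 * z - x) mod int m) mod int m
        = (2 * (2 * z - y) - (2 * z - x)) mod int m"
      by (intro mod_diff_cong) (simp_all add: mod_mult_right_eq)
    moreover have "(2 * z - (2 * y - x) mod int m) mod int m = (2 * z - (2 * y - x)) mod int m"
      by (simp add: mod_diff_right_eq)
    ultimately show ?thesis
      by (simp add: dihedral_op_def algebra_simps)
  qed
qed

end

theory Submission
  imports Defs "HOL-Library.Countable"
begin

text \<open>
  The quarter turns of the cube, labelled by their signed axes, form a six-element quandle: the
  conjugacy class of 4-cycles in the symmetric group on four letters. Replacing a turn by its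
  inverse is a good involution without fixed points, and the quandle is not involutory because
  half turns act non-trivially. Its product with a dihedral quandle, projected to the dihedral
  factor, is an extension with these same properties. For odd order the product stays connected:
  any element of either factor reaches any other in exactly two steps, so the two coordinates can
  be moved simultaneously.
\<close>

section \<open>Criteria for good involutions and connectedness\<close>

context quandle
begin

lemma qinv_eqI:
  assumes "z \<in> Q" "y \<in> Q" "z \<triangleleft> y = x"
  shows "qinv x y = z"
  unfolding qinv_def
proof (rule the1_equality)
  have "x \<in> Q"
    using closed[of z y] assms by simp
  then show "\<exists>!z. z \<in> Q \<and> x = z \<triangleleft> y"
    using assms(2) by (rule unique_quotient)
qed (simp add: assms)

text \<open>By the uniqueness of quotients, composing with the action of \<open>y\<close> tests the
  inversion condition on \<open>\<rho>\<close>, so no definite description has to be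
  evaluated.\<close>

lemma good_involutionI:
  assumes "\<And>x. x \<in> Q \<Longrightarrow> \<rho> x \<in> Q"
    and "\<And>x. x \<in> Q \<Longrightarrow> \<rho> (\<rho> x) = x"
    and "\<And>x y. x \<in> Q \<Longrightarrow> y \<in> Q \<Longrightarrow> (x \<triangleleft> \<rho> y) \<triangleleft> y = x"
    and "\<And>x y. x \<in> Q \<Longrightarrow> y \<in> Q \<Longrightarrow> \<rho> (x \<triangleleft> y) = \<rho> x \<triangleleft> y"
  shows "good_involution \<rho>"
  unfolding good_involution_def
proof (intro conjI ballI)
  show "x \<triangleleft> \<rho> y = qinv x y" if "x \<in> Q" "y \<in> Q" for x y
    using that by (intro qinv_eqI[symmetric] closed assms)
qed (use assms in auto)

lemma connected_if_two_steps:
  assumes "\<And>x y. x \<in> Q \<Longrightarrow> y \<in> Q \<Longrightarrow> \<exists>c\<in>Q. \<exists>d\<in>Q. (x \<triangleleft> c) \<triangleleft> d = y"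
  shows connected
  unfolding connected_def
proof (intro ballI)
  fix x y
  assume x: "x \<in> Q" and "y \<in> Q"
  then obtain c d where cd: "c \<in> Q" "d \<in> Q" "(x \<triangleleft> c) \<triangleleft> d = y"
    using assms by blast
  \<comment> \<open>Multiplication in \<open>BijGroup Q\<close> is composition, so the right factor
    \<open>symmetry c\<close> acts first.\<close>
  let ?g = "symmetry d \<otimes>\<^bsub>BijGroup Q\<^esub> symmetry c"
  have "?g \<in> Inn"
    unfolding Inn_def using cd by (intro generate.eng generate.incl) auto
  moreover have "?g x = y"
    using cd x symmetry_in_BijGroup[of c] symmetry_in_BijGroup[of d]
    by (simp add: BijGroup_def compose_def symmetry_def closed)
  ultimately show "\<exists>g\<in>Inn. g x = y"
    by blast
qed

end

section \<open>Products and transport of quandles\<close>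

lemma quandle_prod:
  assumes "quandle A s" "quandle B t"
  shows "quandle (A \<times> B) (\<lambda>x y. (s (fst x) (fst y), t (snd x) (snd y)))"
proof -
  interpret A: quandle A s by fact
  interpret B: quandle B t by fact
  show ?thesis
  proof
    fix x y z
    assume x: "x \<in> A \<times> B" and y: "y \<in> A \<times> B"
    show "(s (fst x) (fst y), t (snd x) (snd y)) \<in> A \<times> B"
      using x y A.closed B.closed by (simp add: mem_Times_iff)
    show "(s (fst x) (fst x), t (snd x) (snd x)) = x"
      using x A.idem B.idem by (simp add: mem_Times_iff)
    \<comment> \<open>Written as an equivalence, unique solvability yields both existence and
      uniqueness of the solution pair by instantiation.\<close>
    obtain a where a: "\<And>w. w \<in> A \<and> fst x = s w (fst y) \<longleftrightarrow> w = a"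
      using A.unique_quotient[of "fst x" "fst y"] x y unfolding mem_Times_iff by metis
    obtain b where b: "\<And>w. w \<in> B \<and> snd x = t w (snd y) \<longleftrightarrow> w = b"
      using B.unique_quotient[of "snd x" "snd y"] x y unfolding mem_Times_iff by metis
    show "\<exists>!w. w \<in> A \<times> B \<and> x = (s (fst w) (fst y), t (snd w) (snd y))"
    proof (rule ex1I[of _ "(a, b)"])
      show "(a, b) \<in> A \<times> B \<and> x = (s (fst (a, b)) (fst y), t (snd (a, b)) (snd y))"
        using a[of a] b[of b] by (simp add: prod_eq_iff)
      show "w = (a, b)" if "w \<in> A \<times> B \<and> x = (s (fst w) (fst y), t (snd w) (snd y))" for w
        using that a[of "fst w"] b[of "snd w"] by (simp add: prod_eq_iff mem_Times_iff)
    qed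
    assume z: "z \<in> A \<times> B"
    show "(s (fst (s (fst x) (fst y), t (snd x) (snd y))) (fst z),
           t (snd (s (fst x) (fst y), t (snd x) (snd y))) (snd z)) =
          (s (fst (s (fst x) (fst z), t (snd x) (snd z))) (fst (s (fst y) (fst z), t (snd y) (snd z))),
           t (snd (s (fst x) (fst z), t (snd x) (snd z))) (snd (s (fst y) (fst z), t (snd y) (snd z))))"
      using A.self_distrib[of "fst x" "fst y" "fst z"] B.self_distrib[of "snd x" "snd y" "snd z"] x y z
      by (simp add: mem_Times_iff)
  qed
qed

text \<open>Transport of structure along the injection \<open>to_nat\<close>; it moves the product
  of integer quandles to a carrier of natural numbers.\<close>

lemma quandle_to_nat:
  fixes Q :: "'a::countable set"
  assumes "quandle Q s"
  shows "quandle (to_nat ` Q) (\<lambda>x y. to_nat (s (from_nat x) (from_nat y)))"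
proof -
  interpret quandle Q s by fact
  show ?thesis
  proof
    fix x y z :: nat
    assume "x \<in> to_nat ` Q" "y \<in> to_nat ` Q"
    then obtain a b where ab: "a \<in> Q" "b \<in> Q" and xy: "x = to_nat a" "y = to_nat b"
      by blast
    show "to_nat (s (from_nat x) (from_nat y)) \<in> to_nat ` Q"
      using ab by (simp add: xy closed)
    show "to_nat (s (from_nat x) (from_nat x)) = x"
      using ab by (simp add: xy idem)
    obtain c where c: "\<And>w. w \<in> Q \<and> a = s w b \<longleftrightarrow> w = c"
      using unique_quotient[OF ab] by metis
    show "\<exists>!w. w \<in> to_nat ` Q \<and> x = to_nat (s (from_nat w) (from_nat y))"
    proof (rule ex1I[of _ "to_nat c"])
      show "to_nat c \<in> to_nat ` Q \<and> x = to_nat (s (from_nat (to_nat c)) (from_nat y))"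
        using c[of c] by (simp add: xy)
      show "w = to_nat c" if "w \<in> to_nat ` Q \<and> x = to_nat (s (from_nat w) (from_nat y))" for w
        using that c by (force simp: xy)
    qed
    assume "z \<in> to_nat ` Q"
    then obtain d where d: "d \<in> Q" and z: "z = to_nat d"
      by blast
    show "to_nat (s (from_nat (to_nat (s (from_nat x) (from_nat y)))) (from_nat z)) =
          to_nat (s (from_nat (to_nat (s (from_nat x) (from_nat z))))
                    (from_nat (to_nat (s (from_nat y) (from_nat z)))))"
      using self_distrib[OF ab d] by (simp add: xy z)
  qed
qed

section \<open>The six quarter turns of the cube\<close>

text \<open>
  The residues x and x + 3 modulo 6 stand for the two opposite directions of the axis x mod 3;
  y acts by the quarter turn about y, fixing its own axis and exchanging the other two.
\<close>
definition turn_op :: "int \<Rightarrow> int \<Rightarrow> int" where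
  "turn_op x y =
    (if (y - x) mod 3 = 0 then x
     else if (y - x) mod 3 = 1 then (3 - x - y) mod 6
     else (- x - y) mod 6)"

definition turn_inv :: "int \<Rightarrow> int" where
  "turn_inv x = (x + 3) mod 6"

text \<open>Reduces each identity for the turns to finitely many evaluations.\<close>

lemma ball_six: "(\<forall>x\<in>{0..<6::int}. P x) \<longleftrightarrow> P 0 \<and> P 1 \<and> P 2 \<and> P 3 \<and> P 4 \<and> P 5"
proof -
  have "{0..<6::int} = {0, 1, 2, 3, 4, 5}"
    by auto
  then show ?thesis
    by simp
qed

lemma bex_six: "(\<exists>x\<in>{0..<6::int}. P x) \<longleftrightarrow> P 0 \<or> P 1 \<or> P 2 \<or> P 3 \<or> P 4 \<or> P 5"
  using ball_six[of "\<lambda>x. \<not> P x"] by blast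

lemma turn_op_closed: "x \<in> {0..<6} \<Longrightarrow> turn_op x y \<in> {0..<6}"
  by (simp add: turn_op_def)

lemma turn_op_idem: "turn_op x x = x"
  by (simp add: turn_op_def)

lemma turn_op_self_distrib:
  "\<forall>x\<in>{0..<6}. \<forall>y\<in>{0..<6}. \<forall>z\<in>{0..<6}.
    turn_op (turn_op x y) z = turn_op (turn_op x z) (turn_op y z)"
  unfolding ball_six by (simp add: turn_op_def)

lemma turn_inv_closed: "turn_inv x \<in> {0..<6}"
  by (simp add: turn_inv_def)

lemma turn_inv_turn_inv: "x \<in> {0..<6} \<Longrightarrow> turn_inv (turn_inv x) = x"
  by (simp add: turn_inv_def mod_simps)

text \<open>Opposite quarter turns cancel, and a rotation, being linear, preserves opposite
  directions. The first two conjuncts give existence and uniqueness of quotients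
  respectively.\<close>

lemma turn_op_turn_inv:
  "\<forall>x\<in>{0..<6}. \<forall>y\<in>{0..<6}.
    turn_op (turn_op x (turn_inv y)) y = x \<and> turn_op (turn_op x y) (turn_inv y) = x \<and>
    turn_inv (turn_op x y) = turn_op (turn_inv x) y"
  unfolding ball_six by (simp add: turn_op_def turn_inv_def)

text \<open>Geometrically, a half turn about a perpendicular axis reaches the opposite direction. A
  perpendicular direction needs one quarter turn about the third axis, and idempotence fills the
  remaining steps with \<open>c = x\<close>.\<close>

lemma turn_op_two_steps:
  "\<forall>x\<in>{0..<6}. \<forall>y\<in>{0..<6}. \<exists>c\<in>{0..<6}. \<exists>d\<in>{0..<6}. turn_op (turn_op x c) d = y"
  unfolding ball_six bex_six by (simp add: turn_op_def)

lemma quandle_turn: "quandle {0..<6} turn_op"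
proof
  fix x y :: int
  assume xy: "x \<in> {0..<6}" "y \<in> {0..<6}"
  show "\<exists>!z. z \<in> {0..<6} \<and> x = turn_op z y"
  proof (rule ex1I)
    show "turn_op x (turn_inv y) \<in> {0..<6} \<and> x = turn_op (turn_op x (turn_inv y)) y"
      using xy turn_op_closed turn_op_turn_inv by metis
    show "z = turn_op x (turn_inv y)" if "z \<in> {0..<6} \<and> x = turn_op z y" for z
      using xy that turn_op_turn_inv by metis
  qed
qed (use turn_op_closed turn_op_idem turn_op_self_distrib in blast)+

section \<open>Reflections in dihedral quandles\<close>

lemma dihedral_op_involutory:
  "i \<in> dihedral_carrier m \<Longrightarrow> dihedral_op m (dihedral_op m i j) j = i"
  by (simp add: dihedral_op_def dihedral_carrier_def mod_simps)

text \<open>Reflecting in 0 and then in \<open>d\<close> is translation by \<open>2 * d\<close>.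
  Since 2 is a unit modulo an odd number, every translation arises.\<close>

lemma dihedral_two_steps:
  assumes "i \<in> dihedral_carrier (2 * n + 1)" "j \<in> dihedral_carrier (2 * n + 1)"
  shows "\<exists>c\<in>dihedral_carrier (2 * n + 1). \<exists>d\<in>dihedral_carrier (2 * n + 1).
    dihedral_op (2 * n + 1) (dihedral_op (2 * n + 1) i c) d = j"
proof (intro bexI)
  let ?m = "int (2 * n + 1)"
  \<comment> \<open>n + 1 is the inverse of 2 modulo 2 n + 1.\<close>
  let ?d = "((int n + 1) * (j - i)) mod ?m"
  have "dihedral_op (2 * n + 1) (dihedral_op (2 * n + 1) i 0) ?d
      = (2 * ((int n + 1) * (j - i)) - (2 * 0 - i)) mod ?m"
    unfolding dihedral_op_def by (intro mod_diff_cong mod_mult_right_eq mod_mod_trivial)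
  also have "2 * ((int n + 1) * (j - i)) - (2 * 0 - i) = j + (j - i) * ?m"
    by (simp add: algebra_simps)
  also have "(j + (j - i) * ?m) mod ?m = j"
    using assms by (simp add: dihedral_carrier_def del: of_nat_add of_nat_mult of_nat_Suc)
  finally show "dihedral_op (2 * n + 1) (dihedral_op (2 * n + 1) i 0) ?d = j" .
qed (simp_all add: dihedral_carrier_def)

section \<open>The product with the quarter turns as an extension\<close>

theorem theorem3p1:
  fixes n :: nat
  assumes "n > 0"
  shows "\<exists>(E :: nat set) (t :: nat \<Rightarrow> nat \<Rightarrow> nat) (f :: nat \<Rightarrow> int).
    quandle_extension E t (dihedral_carrier (2 * n + 1)) (dihedral_op (2 * n + 1)) f \<and>
    (\<exists>\<rho>. quandle.good_involution E t \<rho> \<and> \<not> quandle.trivial_involution E \<rho>) \<and>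
    quandle.connected E t \<and>
    \<not> quandle.involutory E t"
proof -
  define R r where "R = dihedral_carrier (2 * n + 1)" and "r = dihedral_op (2 * n + 1)"
  define P where "P = R \<times> {0..<6::int}"
  define s where "s = (\<lambda>x y. (r (fst x) (fst y), turn_op (snd x) (snd y)))"
  define E where "E = (to_nat :: int \<times> int \<Rightarrow> nat) ` P"
  define t :: "nat \<Rightarrow> nat \<Rightarrow> nat" where "t = (\<lambda>x y. to_nat (s (from_nat x) (from_nat y)))"
  define f :: "nat \<Rightarrow> int" where "f = (\<lambda>x. fst (from_nat x :: int \<times> int))"
  \<comment> \<open>The dihedral coordinate can stay fixed because reflections are their own
    inverses; reversing the turn inverts its action.\<close>
  define \<rho> :: "nat \<Rightarrow> nat" where
    "\<rho> = (\<lambda>x. to_nat (map_prod id turn_inv (from_nat x :: int \<times> int)))"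
  have quandle_R: "quandle R r"
    unfolding R_def r_def by (rule quandle_dihedral) simp
  have "quandle P s"
    unfolding P_def s_def using quandle_R quandle_turn by (rule quandle_prod)
  then have quandle_E: "quandle E t"
    unfolding E_def t_def by (rule quandle_to_nat)
  interpret quandle E t by (rule quandle_E)
  have zero: "0 \<in> R"
    by (simp add: R_def dihedral_carrier_def)
  \<comment> \<open>Each fibre is a copy of the six turns, which gives the equal
    cardinalities.\<close>
  have fibre: "{e \<in> E. f e = i} = (\<lambda>a. to_nat (i, a)) ` {0..<6::int}" if "i \<in> R" for i
    using that by (auto simp: E_def P_def f_def)
  have fibre_eqpoll: "{e \<in> E. f e = i} \<approx> {0..<6::int}" if "i \<in> R" for i
    unfolding fibre[OF that] by (rule inj_on_image_eqpoll_self) (simp add: inj_on_def)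
  have "quandle_extension E t R r f"
    unfolding quandle_extension_def quandle_hom_def
  proof (intro conjI ballI)
    show "f ` E = R"
      by (force simp: E_def P_def f_def image_image)
    show "{e \<in> E. f e = i} \<approx> {e \<in> E. f e = j}" if "i \<in> R" "j \<in> R" for i j
      using that fibre_eqpoll eqpoll_sym eqpoll_trans by blast
  qed (use quandle_E quandle_R in \<open>auto simp: E_def P_def f_def t_def s_def\<close>)
  moreover have "good_involution \<rho>"
  proof (rule good_involutionI)
    fix x y
    assume "x \<in> E" "y \<in> E"
    then obtain i a j b where
      ij: "i \<in> R" "j \<in> R" and ab: "a \<in> {0..<6::int}" "b \<in> {0..<6::int}" and
      xy: "x = to_nat (i, a)" "y = to_nat (j, b)"
      by (auto simp: E_def P_def)
    have turn: "turn_op (turn_op a (turn_inv b)) b = a"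
      "turn_inv (turn_op a b) = turn_op (turn_inv a) b"
      using ab turn_op_turn_inv by blast+
    show "t (t x (\<rho> y)) y = x"
      using ij dihedral_op_involutory turn by (simp add: xy t_def s_def \<rho>_def R_def r_def)
    show "\<rho> (t x y) = t (\<rho> x) y"
      using turn by (simp add: xy t_def s_def \<rho>_def)
  qed (use turn_inv_closed turn_inv_turn_inv in \<open>auto simp: E_def P_def \<rho>_def\<close>)
  moreover have "\<not> trivial_involution \<rho>"
  proof -
    have "to_nat (0::int, 0::int) \<in> E"
      using zero by (simp add: E_def P_def)
    moreover have "\<rho> (to_nat (0::int, 0::int)) \<noteq> to_nat (0::int, 0::int)"
      by (simp add: \<rho>_def turn_inv_def)
    ultimately show ?thesis
      unfolding trivial_involution_def by blast
  qed
  moreover have connected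
  proof (rule connected_if_two_steps)
    fix x y
    assume "x \<in> E" "y \<in> E"
    then obtain i a j b where
      ij: "i \<in> R" "j \<in> R" and ab: "a \<in> {0..<6::int}" "b \<in> {0..<6::int}" and
      xy: "x = to_nat (i, a)" "y = to_nat (j, b)"
      by (auto simp: E_def P_def)
    obtain k l where kl: "k \<in> R" "l \<in> R" "r (r i k) l = j"
      using dihedral_two_steps ij unfolding R_def r_def by blast
    obtain c d where cd: "c \<in> {0..<6}" "d \<in> {0..<6}" "turn_op (turn_op a c) d = b"
      using turn_op_two_steps ab by blast
    have "to_nat (k, c) \<in> E" "to_nat (l, d) \<in> E"
      using kl cd by (auto simp: E_def P_def)
    moreover have "t (t x (to_nat (k, c))) (to_nat (l, d)) = y"
      using kl cd by (simp add: xy t_def s_def)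
    ultimately show "\<exists>c\<in>E. \<exists>d\<in>E. t (t x c) d = y"
      by blast
  qed
  moreover have "\<not> involutory"
  proof -
    \<comment> \<open>Turning twice about direction 1 takes direction 0 to 2 and then to its
      opposite 3, while the dihedral coordinate stays 0.\<close>
    have "to_nat (0::int, 0::int) \<in> E" "to_nat (0::int, 1::int) \<in> E"
      using zero by (simp_all add: E_def P_def)
    moreover have "t (t (to_nat (0::int, 0::int)) (to_nat (0::int, 1::int))) (to_nat (0::int, 1::int))
        \<noteq> to_nat (0::int, 0::int)"
      by (simp add: t_def s_def turn_op_def)
    ultimately show ?thesis
      unfolding involutory_def by blast
  qed
  ultimately show ?thesis
    unfolding R_def r_def by blast
qed

end
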